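(* Given a connection $\Delta^h$ on a bundle $(E,\pi,M)$, there exists a unique parallel transport $I$ along paths in $(E,\pi,M)$ which generates $\Delta^h$, i.e. such that $\Delta^I=\Delta^h$. Besides, the parallel transport $\mathsf P$ defined by $\Delta^h$ is given by $\mathsf P^\gamma=I^\gamma_{\sigma\to\tau}$ for every $\gamma\colon[\sigma,\tau]\to M$.
   Context: $\mathbb K=\mathbb R$ or $\mathbb C$. $(E,\pi,M)$ is a bundle with projection $\pi\colon E\to M$; $M$ and $E$ are $C^1$ manifolds over $\mathbb K$ of finite dimensions $n\ge 1$ and $n+r$, $r\ge 1$. $J$ denotes an arbitrary real interval, $[\sigma,\tau]$ a closed one. Paths are $C^1$ maps from real intervals (one-sided derivatives at closed endpoints; intervals nondegenerate wherever a tangent vector is taken). Transport along paths: a map $I$ assigning to every path $\gamma\colon J\to M$ maps $I^\gamma_{s\to t}\colon\pi^{-1}(\gamma(s))\to\pi^{-1}(\gamma(t))$, $s,t\in J$, with $I^\gamma_{s\to t}\circ I^\gamma_{r\to s}=I^\gamma_{r\to t}$ and $I^\gamma_{s\to s}=\mathrm{id}$. Put $\bar\gamma_{s_0,p}(t)=I^\gamma_{s_0\to t}(p)$ for $s_0\in J$, $p\in\pi^{-1}(\gamma(s_0))$. A parallel transport along paths is a transport along paths such that: (a) $\bar\gamma_{s_0,p}$ is $C^1$ for every $C^1$ path $\gamma$, $s_0$ and $p$; (b) if $\gamma_i\colon J_i\to M$, $i=1,2$, are $C^1$ with $\gamma_1(s_1)=\gamma_2(s_2)$ and $\dot\gamma_1(s_1)=\dot\gamma_2(s_2)$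 for some $s_i\in J_i$, then $\dot{\bar\gamma}_{1;s_1,p}(s_1)=\dot{\bar\gamma}_{2;s_2,p}(s_2)$ for $p\in\pi^{-1}(\gamma_1(s_1))$, where $\bar\gamma_{i;s_i,p}(t)=I^{\gamma_i}_{s_i\to t}(p)$; (c) if $\gamma_i\colon J_i\to M$, $i=1,2$, are $C^1$ with $\gamma_1(s_1)=\gamma_2(s_2)$, then for every $a_1,a_2\in\mathbb K$ there is a $C^1$ path $\gamma_3\colon J_3\to M$ with $\gamma_3(s_3)=\gamma_1(s_1)$ for some $s_3\in J_3$ and $\dot{\bar\gamma}_{3;s_3,p}(s_3)=a_1\dot{\bar\gamma}_{1;s_1,p}(s_1)+a_2\dot{\bar\gamma}_{2;s_2,p}(s_2)$ for $p\in\pi^{-1}(\gamma_3(s_3))$. Connection: an $n$-dimensional distribution $\Delta^h\colon p\mapsto\Delta^h_p\subseteq T_p(E)$ on $E$ with $\Delta^v_p\oplus\Delta^h_p=T_p(E)$ for all $p\in E$, where $\Delta^v_p=T_p(\pi^{-1}(\pi(p)))$. The connection $\Delta^I$ generated by a parallel transport $I$ along paths is $\Delta^I_p=\{\frac{d}{dt}|_{t=s_0}\bar\gamma_{s_0,p}(t):\gamma\colon J\to M\ C^1\text{ and injective},\ s_0\in J,\ \gamma(s_0)=\pi(p)\}$. A horizontal lift of a $C^1$ path $\gamma\colon J\to M$ is a $C^1$ path $\bar\gamma\colon J\to E$ with $\pi\circ\bar\gamma=\gamma$ and $\dot{\bar\gamma}(s)\in\Delta^h_{\bar\gamma(s)}$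 for all $s$. Connections are such that for each $\gamma$, $s_0\in J$, $p\in\pi^{-1}(\gamma(s_0))$ there is a unique horizontal lift with value $p$ at $s_0$. The parallel transport $\mathsf P$ generated by (assigned to, defined by) $\Delta^h$ assigns to $\gamma\colon[\sigma,\tau]\to M$ the map $\mathsf P^\gamma\colon\pi^{-1}(\gamma(\sigma))\to\pi^{-1}(\gamma(\tau))$, $\mathsf P^\gamma(p)=\bar\gamma_p(\tau)$, where $\bar\gamma_p$ is the horizontal lift of $\gamma$ with $\bar\gamma_p(\sigma)=p$. *)

theory Defs
  imports "HOL-Analysis.Analysis" "HOL-Library.Function_Algebras"
begin

text \<open>
  The ground field \<open>\<real>\<close> or \<open>\<complex>\<close> is a type \<open>'k\<close> of sort \<open>{real_normed_field, euclidean_space}\<close>: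
  \<^typ>\<open>real\<close> and \<^typ>\<open>complex\<close> are instances, and a finite-dimensional field extension of \<open>\<real>\<close>
  with multiplicative norm is one of these two, so up to isometric isomorphism there is no other.
  Dimensions are cardinalities of finite index types: a manifold of dimension \<open>CARD('d)\<close> is
  modelled on \<open>'k ^ 'd\<close>.
\<close>

section \<open>Manifolds of class \<open>C\<^sup>1\<close> over the ground field\<close>

text \<open>
  Differentiability is over \<open>'k\<close>, since the derivative is multiplication by a matrix
  with entries in \<open>'k\<close>; for \<^typ>\<open>complex\<close> this is holomorphy.
\<close>

definition C1_over_on ::
    "('k::{real_normed_field,euclidean_space} ^ 'a \<Rightarrow> 'k ^ 'b) \<Rightarrow> ('k ^ 'a) set \<Rightarrow> bool" where
  "C1_over_on f S \<longleftrightarrow>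
     (\<exists>D :: 'k ^ 'a \<Rightarrow> 'k ^ 'a ^ 'b. continuous_on S D \<and>
        (\<forall>x\<in>S. (f has_derivative (\<lambda>h. D x *v h)) (at x)))"

type_synonym ('p, 'k, 'd) chart = "'p set \<times> ('p \<Rightarrow> ('k, 'd) vec)"

record ('p, 'k, 'd::finite) mfd =
  mtop :: "'p topology"
  atlas :: "('p, 'k, 'd) chart set"

abbreviation points :: "('p, 'k, 'd::finite) mfd \<Rightarrow> 'p set" where
  "points X \<equiv> topspace (mtop X)"

definition charts_at :: "('p, 'k, 'd::finite) mfd \<Rightarrow> 'p \<Rightarrow> ('p, 'k, 'd) chart set" where
  "charts_at X p = {(U, \<phi>) \<in> atlas X. p \<in> U}"

text \<open>Second countability is not part of the definition.\<close>

definition C1_manifold ::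
    "('p, 'k::{real_normed_field,euclidean_space}, 'd::finite) mfd \<Rightarrow> bool" where
  "C1_manifold X \<longleftrightarrow>
     Hausdorff_space (mtop X) \<and>
     (\<Union>(U, \<phi>)\<in>atlas X. U) = points X \<and>
     (\<forall>(U, \<phi>)\<in>atlas X. openin (mtop X) U \<and> open (\<phi> ` U) \<and>
        homeomorphic_map (subtopology (mtop X) U) (top_of_set (\<phi> ` U)) \<phi>) \<and>
     (\<forall>(U, \<phi>)\<in>atlas X. \<forall>(V, \<psi>)\<in>atlas X.
        C1_over_on (\<psi> \<circ> inv_into U \<phi>) (\<phi> ` (U \<inter> V)))"

definition C1_map ::
    "('p, 'k::{real_normed_field,euclidean_space}, 'd::finite) mfd \<Rightarrow> ('q, 'k, 'c::finite) mfd
      \<Rightarrow> ('p \<Rightarrow> 'q) \<Rightarrow> bool" where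
  "C1_map X Y f \<longleftrightarrow>
     continuous_map (mtop X) (mtop Y) f \<and>
     (\<forall>(U, \<phi>)\<in>atlas X. \<forall>(V, \<psi>)\<in>atlas Y.
        C1_over_on (\<psi> \<circ> f \<circ> inv_into U \<phi>) (\<phi> ` (U \<inter> f -` V)))"

definition submersion ::
    "('p, 'k::{real_normed_field,euclidean_space}, 'd::finite) mfd \<Rightarrow> ('q, 'k, 'c::finite) mfd
      \<Rightarrow> ('p \<Rightarrow> 'q) \<Rightarrow> bool" where
  "submersion X Y f \<longleftrightarrow>
     (\<forall>p\<in>points X. \<forall>(U, \<phi>)\<in>charts_at X p. \<forall>(V, \<psi>)\<in>charts_at Y (f p).
        surj (frechet_derivative (\<psi> \<circ> f \<circ> inv_into U \<phi>) (at (\<phi> p))))"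

section \<open>Tangent vectors\<close>

text \<open>
  A tangent vector at \<open>p\<close> is the family of its components in all charts around \<open>p\<close>, related by
  the derivatives of the transition maps. It is extended by \<open>0\<close> to the other charts, so that the
  linear structure is the pointwise one.
\<close>

type_synonym ('p, 'k, 'd) tvec = "('p, 'k, 'd) chart \<Rightarrow> ('k, 'd) vec"

definition tscale :: "'k::field \<Rightarrow> ('p, 'k, 'd::finite) tvec \<Rightarrow> ('p, 'k, 'd) tvec" where
  "tscale a v = (\<lambda>c. a *s v c)"

global_interpretation tvec: vector_space tscale
  by unfold_locales (auto simp: tscale_def fun_eq_iff vec_eq_iff algebra_simps)

definition tangent_space ::
    "('p, 'k::{real_normed_field,euclidean_space}, 'd::finite) mfd \<Rightarrow> 'p
      \<Rightarrow> ('p, 'k, 'd) tvec set" where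
  "tangent_space X p =
     {v. (\<forall>c. c \<notin> charts_at X p \<longrightarrow> v c = 0) \<and>
         (\<forall>(U, \<phi>)\<in>charts_at X p. \<forall>(V, \<psi>)\<in>charts_at X p.
            v (V, \<psi>) = frechet_derivative (\<psi> \<circ> inv_into U \<phi>) (at (\<phi> p)) (v (U, \<phi>)))}"

section \<open>Paths\<close>

text \<open>
  A path is a map defined on the interval \<open>J\<close> only; this is expressed by
  \<^term>\<open>\<gamma> \<in> extensional J\<close>, so that paths that agree on \<open>J\<close> are equal.
  Derivatives are taken within \<open>J\<close>, hence are one-sided at end points belonging to \<open>J\<close>.
  A one-point \<open>J\<close> is allowed; differentiability is then void.
\<close>

definition C1_path ::
    "('p, 'k::{real_normed_field,euclidean_space}, 'd::finite) mfd \<Rightarrow> real set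
      \<Rightarrow> (real \<Rightarrow> 'p) \<Rightarrow> bool" where
  "C1_path X J \<gamma> \<longleftrightarrow>
     is_interval J \<and> \<gamma> \<in> extensional J \<and>
     continuous_map (top_of_set J) (mtop X) \<gamma> \<and>
     (\<forall>(U, \<phi>)\<in>atlas X. \<exists>D. continuous_on {t \<in> J. \<gamma> t \<in> U} D \<and>
        (\<forall>t\<in>{t \<in> J. \<gamma> t \<in> U}. ((\<phi> \<circ> \<gamma>) has_vector_derivative D t) (at t within J)))"

definition nondegenerate :: "real set \<Rightarrow> bool" where
  "nondegenerate J \<longleftrightarrow> (\<exists>s\<in>J. \<exists>t\<in>J. s < t)"

definition velocity ::
    "('p, 'k::{real_normed_field,euclidean_space}, 'd::finite) mfd \<Rightarrow> real set
      \<Rightarrow> (real \<Rightarrow> 'p) \<Rightarrow> real \<Rightarrow> ('p, 'k, 'd) tvec" where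
  "velocity X J \<gamma> s =
     (\<lambda>c. if c \<in> charts_at X (\<gamma> s) then vector_derivative (snd c \<circ> \<gamma>) (at s within J) else 0)"

section \<open>Bundles and connections\<close>

text \<open>
  Local triviality is not required. That the projection is a submersion makes every fibre
  an embedded submanifold of dimension \<open>CARD('r)\<close>, so that its tangent spaces make sense.
\<close>

definition C1_bundle ::
    "('e, 'k::{real_normed_field,euclidean_space}, 'n::finite + 'r::finite) mfd
      \<Rightarrow> ('m, 'k, 'n) mfd \<Rightarrow> ('e \<Rightarrow> 'm) \<Rightarrow> bool" where
  "C1_bundle E M \<pi> \<longleftrightarrow>
     C1_manifold E \<and> C1_manifold M \<and>
     C1_map E M \<pi> \<and> \<pi> ` points E = points M \<and> submersion E M \<pi>"

definition fibre :: "('e, 'k, 'd::finite) mfd \<Rightarrow> ('e \<Rightarrow> 'm) \<Rightarrow> 'm \<Rightarrow> 'e set" where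
  "fibre E \<pi> x = {p \<in> points E. \<pi> p = x}"

text \<open>
  The tangent space at \<open>p\<close> of the fibre through \<open>p\<close>, as a subset of the tangent space of \<open>E\<close>:
  the velocities at \<open>p\<close> of the \<open>C\<^sup>1\<close> paths in \<open>E\<close> that stay in this fibre.
\<close>

definition vertical_space ::
    "('e, 'k::{real_normed_field,euclidean_space}, 'd::finite) mfd \<Rightarrow> ('e \<Rightarrow> 'm) \<Rightarrow> 'e
      \<Rightarrow> ('e, 'k, 'd) tvec set" where
  "vertical_space E \<pi> p =
     {velocity E J c s | J c s. C1_path E J c \<and> nondegenerate J \<and> s \<in> J \<and> c s = p \<and>
        c ` J \<subseteq> fibre E \<pi> (\<pi> p)}"

definition horizontal_distribution ::
    "('e, 'k::{real_normed_field,euclidean_space}, 'n::finite + 'r::finite) mfd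
      \<Rightarrow> ('m, 'k, 'n) mfd \<Rightarrow> ('e \<Rightarrow> 'm) \<Rightarrow> ('e \<Rightarrow> ('e, 'k, 'n + 'r) tvec set) \<Rightarrow> bool" where
  "horizontal_distribution E M \<pi> \<Delta> \<longleftrightarrow>
     (\<forall>p\<in>points E.
        tvec.subspace (\<Delta> p) \<and> \<Delta> p \<subseteq> tangent_space E p \<and> tvec.dim (\<Delta> p) = CARD('n) \<and>
        vertical_space E \<pi> p \<inter> \<Delta> p = {0} \<and>
        {v + w | v w. v \<in> vertical_space E \<pi> p \<and> w \<in> \<Delta> p} = tangent_space E p)"

definition horizontal_lift ::
    "('e, 'k::{real_normed_field,euclidean_space}, 'd::finite) mfd \<Rightarrow> ('e \<Rightarrow> 'm)
      \<Rightarrow> ('e \<Rightarrow> ('e, 'k, 'd) tvec set) \<Rightarrow> real set \<Rightarrow> (real \<Rightarrow> 'm) \<Rightarrow> (real \<Rightarrow> 'e) \<Rightarrow> bool" where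
  "horizontal_lift E \<pi> \<Delta> J \<gamma> c \<longleftrightarrow>
     C1_path E J c \<and> (\<forall>t\<in>J. \<pi> (c t) = \<gamma> t) \<and>
     (nondegenerate J \<longrightarrow> (\<forall>s\<in>J. velocity E J c s \<in> \<Delta> (c s)))"

definition connection ::
    "('e, 'k::{real_normed_field,euclidean_space}, 'n::finite + 'r::finite) mfd
      \<Rightarrow> ('m, 'k, 'n) mfd \<Rightarrow> ('e \<Rightarrow> 'm) \<Rightarrow> ('e \<Rightarrow> ('e, 'k, 'n + 'r) tvec set) \<Rightarrow> bool" where
  "connection E M \<pi> \<Delta> \<longleftrightarrow>
     horizontal_distribution E M \<pi> \<Delta> \<and>
     (\<forall>J \<gamma>. C1_path M J \<gamma> \<longrightarrow>
        (\<forall>s\<in>J. \<forall>p\<in>fibre E \<pi> (\<gamma> s). \<exists>!c. horizontal_lift E \<pi> \<Delta> J \<gamma> c \<and> c s = p))"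

text \<open>The parallel transport generated by a connection.\<close>

definition transport_of_connection ::
    "('e, 'k::{real_normed_field,euclidean_space}, 'd::finite) mfd \<Rightarrow> ('e \<Rightarrow> 'm)
      \<Rightarrow> ('e \<Rightarrow> ('e, 'k, 'd) tvec set) \<Rightarrow> real \<Rightarrow> real \<Rightarrow> (real \<Rightarrow> 'm) \<Rightarrow> 'e \<Rightarrow> 'e" where
  "transport_of_connection E \<pi> \<Delta> \<sigma> \<tau> \<gamma> =
     (\<lambda>p\<in>fibre E \<pi> (\<gamma> \<sigma>). (THE c. horizontal_lift E \<pi> \<Delta> {\<sigma>..\<tau>} \<gamma> c \<and> c \<sigma> = p) \<tau>)"

section \<open>Transports along paths\<close>

text \<open>
  \<open>I J \<gamma> s t\<close> is the map from the fibre over \<open>\<gamma> s\<close> to the fibre over \<open>\<gamma> t\<close>. Outside its domain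
  (\<open>\<gamma>\<close> a path on \<open>J\<close> and \<open>s\<close>, \<open>t\<close> in \<open>J\<close>) the function \<open>I\<close> is \<^term>\<open>undefined\<close>, so that equality
  of transports in the logic is equality of the transports as maps on their domains.
\<close>

type_synonym ('e, 'm) path_family = "real set \<Rightarrow> (real \<Rightarrow> 'm) \<Rightarrow> real \<Rightarrow> real \<Rightarrow> 'e \<Rightarrow> 'e"

definition transport_along_paths ::
    "('e, 'k::{real_normed_field,euclidean_space}, 'd::finite) mfd \<Rightarrow> ('m, 'k, 'n::finite) mfd
      \<Rightarrow> ('e \<Rightarrow> 'm) \<Rightarrow> ('e, 'm) path_family \<Rightarrow> bool" where
  "transport_along_paths E M \<pi> I \<longleftrightarrow>
     (\<forall>J \<gamma> s t.
        if C1_path M J \<gamma> \<and> s \<in> J \<and> t \<in> J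
        then I J \<gamma> s t \<in> fibre E \<pi> (\<gamma> s) \<rightarrow>\<^sub>E fibre E \<pi> (\<gamma> t)
        else I J \<gamma> s t = undefined) \<and>
     (\<forall>J \<gamma>. C1_path M J \<gamma> \<longrightarrow>
        (\<forall>r\<in>J. \<forall>s\<in>J. \<forall>t\<in>J. \<forall>p\<in>fibre E \<pi> (\<gamma> r). I J \<gamma> s t (I J \<gamma> r s p) = I J \<gamma> r t p) \<and>
        (\<forall>s\<in>J. \<forall>p\<in>fibre E \<pi> (\<gamma> s). I J \<gamma> s s p = p))"

definition lift_by ::
    "('e, 'm) path_family \<Rightarrow> real set \<Rightarrow> (real \<Rightarrow> 'm) \<Rightarrow> real \<Rightarrow> 'e \<Rightarrow> real \<Rightarrow> 'e" where
  "lift_by I J \<gamma> s p = (\<lambda>t\<in>J. I J \<gamma> s t p)"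

definition parallel_transport ::
    "('e, 'k::{real_normed_field,euclidean_space}, 'd::finite) mfd \<Rightarrow> ('m, 'k, 'n::finite) mfd
      \<Rightarrow> ('e \<Rightarrow> 'm) \<Rightarrow> ('e, 'm) path_family \<Rightarrow> bool" where
  "parallel_transport E M \<pi> I \<longleftrightarrow>
     transport_along_paths E M \<pi> I \<and>
     (\<forall>J \<gamma>. C1_path M J \<gamma> \<longrightarrow>
        (\<forall>s\<in>J. \<forall>p\<in>fibre E \<pi> (\<gamma> s). C1_path E J (lift_by I J \<gamma> s p))) \<and>
     (\<forall>J\<^sub>1 \<gamma>\<^sub>1 J\<^sub>2 \<gamma>\<^sub>2.
        C1_path M J\<^sub>1 \<gamma>\<^sub>1 \<and> nondegenerate J\<^sub>1 \<and> C1_path M J\<^sub>2 \<gamma>\<^sub>2 \<and> nondegenerate J\<^sub>2 \<longrightarrow>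
        (\<forall>s\<^sub>1\<in>J\<^sub>1. \<forall>s\<^sub>2\<in>J\<^sub>2.
           \<gamma>\<^sub>1 s\<^sub>1 = \<gamma>\<^sub>2 s\<^sub>2 \<and> velocity M J\<^sub>1 \<gamma>\<^sub>1 s\<^sub>1 = velocity M J\<^sub>2 \<gamma>\<^sub>2 s\<^sub>2 \<longrightarrow>
           (\<forall>p\<in>fibre E \<pi> (\<gamma>\<^sub>1 s\<^sub>1).
              velocity E J\<^sub>1 (lift_by I J\<^sub>1 \<gamma>\<^sub>1 s\<^sub>1 p) s\<^sub>1 =
              velocity E J\<^sub>2 (lift_by I J\<^sub>2 \<gamma>\<^sub>2 s\<^sub>2 p) s\<^sub>2))) \<and>
     (\<forall>J\<^sub>1 \<gamma>\<^sub>1 J\<^sub>2 \<gamma>\<^sub>2.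
        C1_path M J\<^sub>1 \<gamma>\<^sub>1 \<and> nondegenerate J\<^sub>1 \<and> C1_path M J\<^sub>2 \<gamma>\<^sub>2 \<and> nondegenerate J\<^sub>2 \<longrightarrow>
        (\<forall>s\<^sub>1\<in>J\<^sub>1. \<forall>s\<^sub>2\<in>J\<^sub>2. \<gamma>\<^sub>1 s\<^sub>1 = \<gamma>\<^sub>2 s\<^sub>2 \<longrightarrow>
           (\<forall>a\<^sub>1 a\<^sub>2. \<exists>J\<^sub>3 \<gamma>\<^sub>3. C1_path M J\<^sub>3 \<gamma>\<^sub>3 \<and> nondegenerate J\<^sub>3 \<and>
              (\<exists>s\<^sub>3\<in>J\<^sub>3. \<gamma>\<^sub>3 s\<^sub>3 = \<gamma>\<^sub>1 s\<^sub>1 \<and>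
                 (\<forall>p\<in>fibre E \<pi> (\<gamma>\<^sub>3 s\<^sub>3).
                    velocity E J\<^sub>3 (lift_by I J\<^sub>3 \<gamma>\<^sub>3 s\<^sub>3 p) s\<^sub>3 =
                    tscale a\<^sub>1 (velocity E J\<^sub>1 (lift_by I J\<^sub>1 \<gamma>\<^sub>1 s\<^sub>1 p) s\<^sub>1) +
                    tscale a\<^sub>2 (velocity E J\<^sub>2 (lift_by I J\<^sub>2 \<gamma>\<^sub>2 s\<^sub>2 p) s\<^sub>2))))))"

definition connection_of_transport ::
    "('e, 'k::{real_normed_field,euclidean_space}, 'd::finite) mfd \<Rightarrow> ('m, 'k, 'n::finite) mfd
      \<Rightarrow> ('e \<Rightarrow> 'm) \<Rightarrow> ('e, 'm) path_family \<Rightarrow> 'e \<Rightarrow> ('e, 'k, 'd) tvec set" where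
  "connection_of_transport E M \<pi> I p =
     {velocity E J (lift_by I J \<gamma> s p) s | J \<gamma> s.
        C1_path M J \<gamma> \<and> nondegenerate J \<and> inj_on \<gamma> J \<and> s \<in> J \<and> \<gamma> s = \<pi> p}"

definition generates ::
    "('e, 'k::{real_normed_field,euclidean_space}, 'd::finite) mfd \<Rightarrow> ('m, 'k, 'n::finite) mfd
      \<Rightarrow> ('e \<Rightarrow> 'm) \<Rightarrow> ('e, 'm) path_family \<Rightarrow> ('e \<Rightarrow> ('e, 'k, 'd) tvec set) \<Rightarrow> bool" where
  "generates E M \<pi> I \<Delta> \<longleftrightarrow> (\<forall>p\<in>points E. connection_of_transport E M \<pi> I p = \<Delta> p)"

end

theory Submission
  imports Defs
begin

text \<open>
  The transport is \<open>I J \<gamma> s t p = c t\<close> for the horizontal lift \<open>c\<close> of \<open>\<gamma>\<close> with \<open>c s = p\<close>. A vector in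
  \<open>\<Delta> p\<close> is determined by its projection to \<open>M\<close>, so the velocity of a lift depends, linearly, only
  on the velocity of the path; with injective paths of arbitrary velocity this gives the
  parallel transport axioms and the equality of the generated connection with \<open>\<Delta>\<close>. Conversely, if \<open>I\<close>
  generates \<open>\<Delta>\<close>, then at each parameter the velocity of a curve transported by \<open>I\<close> along \<open>\<gamma>\<close> equals that of one
  transported along an injective path with the same velocity as \<open>\<gamma>\<close>, hence lies in \<open>\<Delta>\<close>; so the curve
  is the horizontal lift.
\<close>

section \<open>Linear algebra and differential calculus in coordinates\<close>

text \<open>A basis of \<open>S\<close> has \<open>CARD('n)\<close> elements and its image spans the
  target, so the image is a basis with equally many elements. The count is made inside
  \<open>S\<close> because the space of all component families may be infinite-dimensional.\<close>

lemma linear_dim_eq_surj_imp_inj_on: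
  fixes f :: "('p, 'k::field, 'd::finite) tvec \<Rightarrow> 'k ^ 'n::finite"
  assumes f: "Vector_Spaces.linear tscale (*s) f"
    and S: "tvec.subspace S" "tvec.dim S = CARD('n)" and onto: "f ` S = UNIV"
  shows "inj_on f S"
proof -
  interpret f: Vector_Spaces.linear tscale "(*s)" f by fact
  obtain B where B: "B \<subseteq> S" "tvec.independent B" "S \<subseteq> tvec.span B" "card B = CARD('n)"
    using tvec.basis_exists[of S] S(2) by metis
  \<comment> \<open>An infinite set has \<open>card\<close> 0, whereas \<open>CARD('n)\<close> is
    positive.\<close>
  have fin: "finite B"
    using B(4) by (metis card.infinite zero_less_card_finite less_irrefl)
  have span: "vec.span (f ` B) = UNIV"
    using f.span_image[of B] B(3) onto by blast
  have card: "CARD('n) \<le> card (f ` B)"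
    using vec.dim_le_card[of UNIV "f ` B"] span fin unfolding vec_dim_card by simp
  then have inj: "inj_on f B"
    using card_image_le[OF fin, of f] B(4) by (intro eq_card_imp_inj_on fin) linarith
  have "vec.independent (f ` B)"
    using vec.card_le_dim_spanning[of "f ` B" UNIV] span card_image[OF inj] B(4) fin
    unfolding vec_dim_card by simp
  then have "inj_on f (tvec.span B)"
    using inj f.inj_on_span_iff_independent_image by blast
  then show ?thesis
    using B(3) inj_on_subset by blast
qed

text \<open>The chain rule for a curve followed by a C1 map. The derivative of \<open>f\<close> is
  taken in the full space, so one-sided derivatives of \<open>c\<close> at end points are
  covered.\<close>

lemma has_vector_derivative_C1_compose:
  assumes "C1_over_on f S" "(c has_vector_derivative v) (at t within J)" "c t \<in> S"
  shows "((f \<circ> c) has_vector_derivative frechet_derivative f (at (c t)) v) (at t within J)"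
proof -
  obtain D where D: "(f has_derivative (\<lambda>h. D *v h)) (at (c t))"
    using assms(1,3) unfolding C1_over_on_def by blast
  have "((\<lambda>x. f (c x)) has_derivative (\<lambda>x. D *v (x *\<^sub>R v))) (at t within J)"
    using assms(2) D unfolding has_vector_derivative_def by (rule has_derivative_compose)
  moreover have "D *v (x *\<^sub>R v) = x *\<^sub>R (D *v v)" for x
    by (simp add: linear_cmul)
  ultimately show ?thesis
    unfolding has_vector_derivative_def frechet_derivative_at[OF D, symmetric] comp_def by simp
qed

lemma linear_frechet_derivative_C1:
  assumes "C1_over_on f S" "x \<in> S"
  shows "Vector_Spaces.linear (*s) (*s) (frechet_derivative f (at x))"
proof -
  obtain D where D: "(f has_derivative (\<lambda>h. D *v h)) (at x)"
    using assms unfolding C1_over_on_def by blast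
  show ?thesis
    unfolding frechet_derivative_at[OF D, symmetric] by (rule matrix_vector_mul_linear_gen)
qed

text \<open>On \<open>S\<close> the Frechet derivative is given by a continuous matrix field, and
  matrix-vector products are continuous. This yields the continuous derivative that
  \<open>C1_path\<close> demands in each chart.\<close>

lemma continuous_on_frechet_derivative_C1:
  assumes f: "C1_over_on f S" and c: "continuous_on T c" "c ` T \<subseteq> S" and v: "continuous_on T v"
  shows "continuous_on T (\<lambda>t. frechet_derivative f (at (c t)) (v t))"
proof -
  obtain D where D: "continuous_on S D" "\<And>x. x \<in> S \<Longrightarrow> (f has_derivative (\<lambda>h. D x *v h)) (at x)"
    using f unfolding C1_over_on_def by blast
  have "continuous_on T (D \<circ> c)"
    using c D(1) by (meson continuous_on_compose continuous_on_subset)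
  then have "continuous_on T (\<lambda>t. D (c t) *v v t)"
    unfolding matrix_vector_mult_def comp_def using v by (intro continuous_intros)
  then show ?thesis
  proof (rule continuous_on_eq)
    fix t assume "t \<in> T"
    then have "c t \<in> S" using c by blast
    then show "D (c t) *v v t = frechet_derivative f (at (c t)) (v t)"
      using frechet_derivative_at[OF D(2)] by metis
  qed
qed

section \<open>Tangent vectors, charts and velocities of paths\<close>

text \<open>A connected set with two points has no isolated point. Hence derivatives within
  \<open>J\<close> are unique, so that \<open>velocity\<close> is the actual derivative, at end
  points too.\<close>

lemma nondegenerate_interval_at_neq_bot:
  assumes "is_interval J" "nondegenerate J" "s \<in> J"
  shows "at s within J \<noteq> bot"
proof -
  have "s islimpt J"
    using assms by (intro connected_imp_perfect)
      (auto simp: is_interval_connected_1 nondegenerate_def)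
  then show ?thesis
    using trivial_limit_within by blast
qed

text \<open>The transition derivatives compute every component at \<open>p\<close> from the one in
  \<open>d\<close>, and components in charts not around \<open>p\<close> are 0. Velocities can thus
  be compared in a single chart.\<close>

lemma tangent_space_eqI:
  fixes X :: "('p, 'k::{real_normed_field,euclidean_space}, 'd::finite) mfd"
  assumes "v \<in> tangent_space X p" "w \<in> tangent_space X p"
    and "d \<in> charts_at X p" "v d = w d"
  shows "v = w"
proof
  fix e :: "('p, 'k, 'd) chart"
  obtain U \<phi> V \<psi> where de: "d = (U, \<phi>)" "e = (V, \<psi>)" by (cases d, cases e)
  show "v e = w e"
  proof (cases "e \<in> charts_at X p")
    case True
    have "z e = frechet_derivative (\<psi> \<circ> inv_into U \<phi>) (at (\<phi> p)) (z d)"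
      if "z \<in> tangent_space X p" for z
      using that True assms(3) unfolding de tangent_space_def by blast
    then show ?thesis
      using assms by metis
  next
    case False
    have "z e = 0" if "z \<in> tangent_space X p" for z
      using that False unfolding tangent_space_def by blast
    then show ?thesis
      using assms(1,2) by metis
  qed
qed

context
  fixes X :: "('p, 'k::{real_normed_field,euclidean_space}, 'd::finite) mfd"
  assumes X: "C1_manifold X"
begin

lemma chart_openin: "(U, \<phi>) \<in> atlas X \<Longrightarrow> openin (mtop X) U"
  and chart_open_image: "(U, \<phi>) \<in> atlas X \<Longrightarrow> open (\<phi> ` U)"
  and chart_homeomorphic_map:
    "(U, \<phi>) \<in> atlas X \<Longrightarrow> homeomorphic_map (subtopology (mtop X) U) (top_of_set (\<phi> ` U)) \<phi>"
  using X unfolding C1_manifold_def by blast+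

lemma chart_transition_C1:
  "\<lbrakk>(U, \<phi>) \<in> atlas X; (V, \<psi>) \<in> atlas X\<rbrakk> \<Longrightarrow> C1_over_on (\<psi> \<circ> inv_into U \<phi>) (\<phi> ` (U \<inter> V))"
  using X unfolding C1_manifold_def by blast

lemma chart_topspace: "(U, \<phi>) \<in> atlas X \<Longrightarrow> U \<subseteq> points X"
  using chart_openin openin_subset by blast

lemma chart_inj_on: "(U, \<phi>) \<in> atlas X \<Longrightarrow> inj_on \<phi> U"
  using homeomorphic_imp_injective_map[OF chart_homeomorphic_map] chart_topspace
  by (metis inf.absorb_iff2 topspace_subtopology)

lemma ex_chart_at:
  assumes "p \<in> points X" obtains U \<phi> where "(U, \<phi>) \<in> charts_at X p"
  using assms X unfolding C1_manifold_def charts_at_def by blast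

text \<open>The continuous inverse that comes with the homeomorphism agrees with
  \<open>inv_into U \<phi>\<close> on the image of the chart.\<close>

lemma chart_inverse_continuous_map:
  assumes "(U, \<phi>) \<in> atlas X"
  shows "continuous_map (top_of_set (\<phi> ` U)) (mtop X) (inv_into U \<phi>)"
proof -
  obtain g where g: "homeomorphic_maps (subtopology (mtop X) U) (top_of_set (\<phi> ` U)) \<phi> g"
    using chart_homeomorphic_map[OF assms] homeomorphic_map_maps by blast
  have top: "topspace (subtopology (mtop X) U) = U"
    using chart_topspace[OF assms] by auto
  have "continuous_map (top_of_set (\<phi> ` U)) (mtop X) g"
    using g unfolding homeomorphic_maps_def continuous_map_in_subtopology by blast
  moreover have "g y = inv_into U \<phi> y" if "y \<in> \<phi> ` U" for y
    using that g top chart_inj_on[OF assms] unfolding homeomorphic_maps_def by auto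
  ultimately show ?thesis
    by (rule continuous_map_eq) auto
qed

text \<open>This is compatibility of charts, phrased so that the change of components of a velocity
  between charts becomes a case of \<open>C1_map_velocity\<close>.\<close>

lemma C1_map_id: "C1_map X X id"
proof -
  have "C1_over_on (\<psi> \<circ> id \<circ> inv_into U \<phi>) (\<phi> ` (U \<inter> id -` V))"
    if "(U, \<phi>) \<in> atlas X" "(V, \<psi>) \<in> atlas X" for U V \<phi> \<psi>
    using chart_transition_C1[OF that] by simp
  then show ?thesis
    unfolding C1_map_def by auto
qed

lemma C1_path_has_velocity:
  assumes c: "C1_path X J c" "nondegenerate J" "s \<in> J" and U: "(U, \<phi>) \<in> charts_at X (c s)"
  shows "((\<phi> \<circ> c) has_vector_derivative velocity X J c s (U, \<phi>)) (at s within J)"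
proof -
  obtain D where "((\<phi> \<circ> c) has_vector_derivative D) (at s within J)"
    using c U unfolding C1_path_def charts_at_def by blast
  moreover have "at s within J \<noteq> bot"
    using c nondegenerate_interval_at_neq_bot unfolding C1_path_def by blast
  ultimately have "vector_derivative (\<phi> \<circ> c) (at s within J) = D"
    using vector_derivative_within by blast
  then have "velocity X J c s (U, \<phi>) = D"
    using U by (simp add: velocity_def)
  with \<open>(_ has_vector_derivative D) _\<close> show ?thesis by simp
qed

lemma C1_path_eventually_in_chart:
  assumes c: "C1_path X J c" "s \<in> J" and U: "(U, \<phi>) \<in> charts_at X (c s)"
  shows "\<forall>\<^sub>F t in at s within J. t \<in> J \<and> c t \<in> U"
proof -
  have "openin (top_of_set J) {t \<in> J. c t \<in> U}"
    using c U chart_openin openin_continuous_map_preimage[of "top_of_set J" "mtop X" c U]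
    unfolding C1_path_def charts_at_def by auto
  then obtain T where "open T" "{t \<in> J. c t \<in> U} = J \<inter> T"
    using openin_open by blast
  then show ?thesis
    unfolding eventually_at_topological using c U unfolding charts_at_def by blast
qed

text \<open>Near \<open>s\<close>, the curve \<open>\<psi> \<circ> \<gamma>\<close> is the chart
  expression of \<open>f\<close> after \<open>\<phi> \<circ> c\<close>, so the chain rule applies.
  Agreement of \<open>\<gamma>\<close> with \<open>f \<circ> c\<close> is asked for on
  \<open>J\<close> only, so \<open>\<gamma>\<close> may be a constant map that is not
  extensional.\<close>

lemma C1_map_velocity:
  fixes Y :: "('q, 'k, 'c::finite) mfd"
  assumes f: "C1_map X Y f" and c: "C1_path X J c" "nondegenerate J" "s \<in> J"
    and \<gamma>: "\<And>t. t \<in> J \<Longrightarrow> f (c t) = \<gamma> t"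
    and U: "(U, \<phi>) \<in> charts_at X (c s)" and V: "(V, \<psi>) \<in> charts_at Y (\<gamma> s)"
  shows "velocity Y J \<gamma> s (V, \<psi>) =
    frechet_derivative (\<psi> \<circ> f \<circ> inv_into U \<phi>) (at (\<phi> (c s))) (velocity X J c s (U, \<phi>))"
    (is "_ = ?v")
proof -
  have at: "(U, \<phi>) \<in> atlas X" "c s \<in> U" "(V, \<psi>) \<in> atlas Y" "f (c s) \<in> V"
    using U V \<gamma> c by (auto simp: charts_at_def)
  have C1: "C1_over_on (\<psi> \<circ> f \<circ> inv_into U \<phi>) (\<phi> ` (U \<inter> f -` V))"
    using f at unfolding C1_map_def by blast
  have inv: "inv_into U \<phi> (\<phi> (c t)) = c t" if "c t \<in> U" for t
    using chart_inj_on[OF at(1)] that by simp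
  have "((\<psi> \<circ> f \<circ> inv_into U \<phi>) \<circ> (\<phi> \<circ> c) has_vector_derivative ?v) (at s within J)"
    using has_vector_derivative_C1_compose[OF C1 C1_path_has_velocity[OF c U]] at by auto
  \<comment> \<open>\<open>inv_into U \<phi>\<close> undoes \<open>\<phi>\<close> only inside
    \<open>U\<close>, where \<open>c\<close> stays for parameters near \<open>s\<close>.\<close>
  moreover have "\<forall>\<^sub>F t in at s within J.
      ((\<psi> \<circ> f \<circ> inv_into U \<phi>) \<circ> (\<phi> \<circ> c)) t = (\<psi> \<circ> \<gamma>) t"
    using C1_path_eventually_in_chart[OF c(1,3) U] by eventually_elim (simp add: inv \<gamma>)
  ultimately have "(\<psi> \<circ> \<gamma> has_vector_derivative ?v) (at s within J)"
    unfolding has_vector_derivative_def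
    by (rule has_derivative_transform_eventually) (use inv \<gamma> at c in auto)
  then show ?thesis
    using V c nondegenerate_interval_at_neq_bot
    unfolding velocity_def C1_path_def by (simp add: vector_derivative_within)
qed

lemma velocity_in_tangent_space:
  assumes c: "C1_path X J c" "nondegenerate J" "s \<in> J"
  shows "velocity X J c s \<in> tangent_space X (c s)"
  unfolding tangent_space_def
proof (intro CollectI conjI)
  show "\<forall>d. d \<notin> charts_at X (c s) \<longrightarrow> velocity X J c s d = 0"
    by (simp add: velocity_def)
  have "velocity X J c s (V, \<psi>) =
      frechet_derivative (\<psi> \<circ> inv_into U \<phi>) (at (\<phi> (c s))) (velocity X J c s (U, \<phi>))"
    if "(U, \<phi>) \<in> charts_at X (c s)" "(V, \<psi>) \<in> charts_at X (c s)" for U V \<phi> \<psi>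
    using C1_map_velocity[where f = id and Y = X and \<gamma> = c, OF C1_map_id c _ that] by simp
  then show "\<forall>(U, \<phi>)\<in>charts_at X (c s). \<forall>(V, \<psi>)\<in>charts_at X (c s). velocity X J c s (V, \<psi>) =
      frechet_derivative (\<psi> \<circ> inv_into U \<phi>) (at (\<phi> (c s))) (velocity X J c s (U, \<phi>))"
    by blast
qed

section \<open>Injective paths with prescribed velocity\<close>

text \<open>A short straight segment in the chart is pulled back to the manifold, with
  \<open>p\<close> at its left end point. Such paths realise arbitrary vectors as velocities and are
  admissible in \<open>connection_of_transport\<close>.\<close>

lemma injective_C1_path_with_velocity:
  assumes U: "(U, \<phi>) \<in> charts_at X p"
  obtains J \<gamma> s where "C1_path X J \<gamma>" "nondegenerate J" "inj_on \<gamma> J" "s \<in> J" "\<gamma> s = p"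
    "velocity X J \<gamma> s (U, \<phi>) = v"
proof -
  have at: "(U, \<phi>) \<in> atlas X" "p \<in> U"
    using U by (auto simp: charts_at_def)
  obtain e where e: "e > 0" "ball (\<phi> p) e \<subseteq> \<phi> ` U"
    using chart_open_image[OF at(1)] at(2) open_contains_ball by blast
  \<comment> \<open>For \<open>v = 0\<close> injectivity forces a nonlinear parameter: a line traversed as \<open>t\<^sup>2\<close>.\<close>
  obtain u :: "'k ^ 'd" and f f' :: "real \<Rightarrow> real" where f: "u \<noteq> 0" "inj_on f {0..1}" "f 0 = 0" "f' 0 *\<^sub>R u = v"
    "\<And>t. (f has_real_derivative f' t) (at t)" "continuous_on UNIV f'" "\<And>t. t \<in> {0..1} \<Longrightarrow> \<bar>f t\<bar> \<le> t"
  proof (cases "v = 0")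
    case True
    show thesis
    proof (rule that[of 1 "\<lambda>t. t\<^sup>2" "\<lambda>t. 2 * t"])
      show "inj_on (\<lambda>t::real. t\<^sup>2) {0..1}" by (auto simp: inj_on_def)
      show "\<bar>t\<^sup>2\<bar> \<le> t" if "t \<in> {0..1}" for t :: real
        using that by (simp add: power2_eq_square mult_left_le)
    qed (use True in \<open>auto intro!: derivative_eq_intros continuous_intros\<close>)
  next
    case False
    show thesis
      by (rule that[of v "\<lambda>t. t" "\<lambda>t. 1"]) (use False in auto)
  qed
  \<comment> \<open>The bound 1 keeps the parameters where \<open>f\<close> is injective and at most
    \<open>t\<close> in absolute value; the other bound then keeps the segment inside the ball of
    radius \<open>e\<close>.\<close>
  define \<delta> where "\<delta> = min 1 (e / (2 * norm u))"
  have \<delta>: "0 < \<delta>" "\<delta> \<le> 1" "\<delta> * norm u < e"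
    using f(1) e(1) by (auto simp: \<delta>_def min_def field_simps)
  define J where "J = {0..\<delta>}"
  define l where "l t = \<phi> p + f t *\<^sub>R u" for t
  define \<gamma> where "\<gamma> = restrict (inv_into U \<phi> \<circ> l) J"
  have l': "(l has_vector_derivative f' t *\<^sub>R u) (at t within J)" for t
    unfolding l_def using f(5)[of t]
    by (auto intro!: derivative_eq_intros simp: has_real_derivative_iff_has_vector_derivative
        intro: has_vector_derivative_at_within)
  have lU: "l t \<in> \<phi> ` U" if "t \<in> J" for t
  proof -
    have "\<bar>f t\<bar> \<le> \<delta>" using f(7)[of t] that \<delta> by (auto simp: J_def)
    then have "norm (f t *\<^sub>R u) < e"
      using \<delta>(3) mult_right_mono[of "\<bar>f t\<bar>" \<delta> "norm u"] by simp
    then show ?thesis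
      using e(2) by (auto simp: l_def dist_norm subset_iff)
  qed
  have lc: "continuous_on J l"
    using l' has_vector_derivative_continuous continuous_on_eq_continuous_within by blast
  have "nondegenerate J"
    unfolding nondegenerate_def J_def using \<delta> by (intro bexI[of _ 0] bexI[of _ \<delta>]) auto
  then have J: "is_interval J" "nondegenerate J" "0 \<in> J" "J \<subseteq> {0..1}"
    using \<delta> by (auto simp: J_def is_interval_cc)
  have \<gamma>0: "\<gamma> 0 = p"
    using J at f(3) chart_inj_on[OF at(1)] by (simp add: \<gamma>_def l_def)
  have \<phi>\<gamma>: "\<phi> (\<gamma> t) = l t" "\<gamma> t \<in> U" if "t \<in> J" for t
    using lU[OF that] that by (auto simp: \<gamma>_def f_inv_into_f inv_into_into)
  have path: "C1_path X J \<gamma>"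
    unfolding C1_path_def
  proof (intro conjI ballI)
    have "continuous_map (top_of_set J) (top_of_set (\<phi> ` U)) l"
      using lc lU by (auto simp: continuous_map_in_subtopology)
    then have "continuous_map (top_of_set J) (mtop X) (inv_into U \<phi> \<circ> l)"
      using chart_inverse_continuous_map[OF at(1)] continuous_map_compose by blast
    then show "continuous_map (top_of_set J) (mtop X) \<gamma>"
      by (rule continuous_map_eq) (simp add: \<gamma>_def)
  next
    fix c assume "c \<in> atlas X"
    moreover obtain V \<psi> where c: "c = (V, \<psi>)" by (cases c)
    ultimately have V: "(V, \<psi>) \<in> atlas X" by simp
    define T where "T = {t \<in> J. \<gamma> t \<in> V}"
    have lT: "l t \<in> \<phi> ` (U \<inter> V)" if "t \<in> T" for t
      using \<phi>\<gamma>[of t] that unfolding T_def by (metis (lifting) IntI imageI mem_Collect_eq)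
    \<comment> \<open>In another chart the path is the transition map after \<open>l\<close>, and
      \<open>D\<close> is its derivative by the chain rule.\<close>
    define D where "D t = frechet_derivative (\<psi> \<circ> inv_into U \<phi>) (at (l t)) (f' t *\<^sub>R u)" for t
    have "continuous_on T D"
      unfolding D_def
      by (rule continuous_on_frechet_derivative_C1[OF chart_transition_C1[OF at(1) V]])
        (use lT lc f(6) in \<open>auto intro!: continuous_intros simp: T_def intro: continuous_on_subset\<close>)
    moreover have "(\<psi> \<circ> \<gamma> has_vector_derivative D t) (at t within J)" if "t \<in> T" for t
    proof (rule has_vector_derivative_transform)
      show "((\<psi> \<circ> inv_into U \<phi>) \<circ> l has_vector_derivative D t) (at t within J)"
        unfolding D_def
        using has_vector_derivative_C1_compose[OF chart_transition_C1[OF at(1) V] l' lT[OF that]] .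
    qed (use that in \<open>auto simp: T_def \<gamma>_def\<close>)
    ultimately show "case c of (V, \<psi>) \<Rightarrow> \<exists>D. continuous_on {t \<in> J. \<gamma> t \<in> V} D \<and>
        (\<forall>t\<in>{t \<in> J. \<gamma> t \<in> V}. (\<psi> \<circ> \<gamma> has_vector_derivative D t) (at t within J))"
      unfolding c T_def by auto
  qed (use J in \<open>auto simp: \<gamma>_def\<close>)
  have "inj_on l J"
    using f(1,2) J(4) unfolding l_def inj_on_def by (auto simp: subset_iff)
  then have inj: "inj_on \<gamma> J"
    using \<phi>\<gamma>(1) unfolding inj_on_def by metis
  have "(\<phi> \<circ> \<gamma> has_vector_derivative f' 0 *\<^sub>R u) (at 0 within J)"
    by (rule has_vector_derivative_transform[OF J(3) _ l']) (simp add: \<phi>\<gamma>)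
  moreover have "(\<phi> \<circ> \<gamma> has_vector_derivative velocity X J \<gamma> 0 (U, \<phi>)) (at 0 within J)"
    using C1_path_has_velocity[OF path J(2,3)] U \<gamma>0 by simp
  ultimately have "velocity X J \<gamma> 0 (U, \<phi>) = v"
    using vector_derivative_within[OF nondegenerate_interval_at_neq_bot[OF J(1-3)]] f(4) by metis
  then show thesis
    using that path J inj \<gamma>0 by blast
qed

end

lemma C1_path_in_points: "\<lbrakk>C1_path X J c; s \<in> J\<rbrakk> \<Longrightarrow> c s \<in> points X"
  unfolding C1_path_def continuous_map_def by auto

section \<open>Transport by horizontal lifts\<close>

text \<open>The value \<open>undefined\<close> outside the domain, and the restriction to the fibre
  inside it, are those prescribed by \<open>transport_along_paths\<close>, so that uniqueness can be
  an equality of functions.\<close>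

definition transport_along ::
    "('e, 'k::{real_normed_field,euclidean_space}, 'd::finite) mfd \<Rightarrow> ('m, 'k, 'n::finite) mfd
      \<Rightarrow> ('e \<Rightarrow> 'm) \<Rightarrow> ('e \<Rightarrow> ('e, 'k, 'd) tvec set) \<Rightarrow> ('e, 'm) path_family" where
  "transport_along E M \<pi> \<Delta> J \<gamma> s t =
     (if C1_path M J \<gamma> \<and> s \<in> J \<and> t \<in> J
      then \<lambda>p\<in>fibre E \<pi> (\<gamma> s). (THE c. horizontal_lift E \<pi> \<Delta> J \<gamma> c \<and> c s = p) t
      else undefined)"

text \<open>For \<open>J = {\<sigma>..\<tau>}\<close> both sides are the same description by
  horizontal lifts; \<open>\<sigma> \<le> \<tau>\<close> puts both end points into
  \<open>J\<close>.\<close>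

lemma transport_of_connection_eq:
  assumes "\<sigma> \<le> \<tau>" "C1_path M {\<sigma>..\<tau>} \<gamma>"
  shows "transport_of_connection E \<pi> \<Delta> \<sigma> \<tau> \<gamma> = transport_along E M \<pi> \<Delta> {\<sigma>..\<tau>} \<gamma> \<sigma> \<tau>"
  using assms by (simp add: transport_of_connection_def transport_along_def)

context
  fixes E :: "('e, 'k::{real_normed_field,euclidean_space}, 'n::finite + 'r::finite) mfd"
    and M :: "('m, 'k, 'n) mfd"
    and \<pi> :: "'e \<Rightarrow> 'm"
    and \<Delta> :: "'e \<Rightarrow> ('e, 'k, 'n + 'r) tvec set"
  assumes is_bundle: "C1_bundle E M \<pi>" and is_connection: "connection E M \<pi> \<Delta>"
begin

lemma E: "C1_manifold E" and M: "C1_manifold M" and proj: "C1_map E M \<pi>"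
  and proj_image: "\<pi> ` points E = points M" and submersion_proj: "submersion E M \<pi>"
  using is_bundle by (simp_all add: C1_bundle_def)

lemma horizontal_subspace: "p \<in> points E \<Longrightarrow> tvec.subspace (\<Delta> p)"
  and horizontal_dim: "p \<in> points E \<Longrightarrow> tvec.dim (\<Delta> p) = CARD('n)"
  and vertical_plus_horizontal: "p \<in> points E \<Longrightarrow>
    {v + w | v w. v \<in> vertical_space E \<pi> p \<and> w \<in> \<Delta> p} = tangent_space E p"
  using is_connection by (simp_all add: connection_def horizontal_distribution_def)

lemma ex1_horizontal_lift:
  "\<lbrakk>C1_path M J \<gamma>; s \<in> J; p \<in> fibre E \<pi> (\<gamma> s)\<rbrakk> \<Longrightarrow> \<exists>!c. horizontal_lift E \<pi> \<Delta> J \<gamma> c \<and> c s = p"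
  using is_connection by (simp add: connection_def)

section \<open>The derivative of the projection on vertical and horizontal vectors\<close>

lemma linear_proj_derivative:
  assumes "(U, \<phi>) \<in> charts_at E p" "(V, \<psi>) \<in> charts_at M (\<pi> p)"
  shows "Vector_Spaces.linear (*s) (*s) (frechet_derivative (\<psi> \<circ> \<pi> \<circ> inv_into U \<phi>) (at (\<phi> p)))"
proof (rule linear_frechet_derivative_C1)
  show "C1_over_on (\<psi> \<circ> \<pi> \<circ> inv_into U \<phi>) (\<phi> ` (U \<inter> \<pi> -` V))"
    using proj assms unfolding C1_map_def charts_at_def by blast
qed (use assms in \<open>auto simp: charts_at_def\<close>)

text \<open>A vertical vector is the velocity of a path inside one fibre, and the projection of that
  path is constant.\<close>

lemma vertical_proj_derivative:
  assumes U: "(U, \<phi>) \<in> charts_at E p" and V: "(V, \<psi>) \<in> charts_at M (\<pi> p)"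
    and v: "v \<in> vertical_space E \<pi> p"
  shows "frechet_derivative (\<psi> \<circ> \<pi> \<circ> inv_into U \<phi>) (at (\<phi> p)) (v (U, \<phi>)) = 0"
proof -
  obtain J c s where c: "C1_path E J c" "nondegenerate J" "s \<in> J" and p: "c s = p"
    and sub: "c ` J \<subseteq> fibre E \<pi> (\<pi> p)" and v: "v = velocity E J c s"
    using v unfolding vertical_space_def by blast
  have "velocity M J (\<lambda>_. \<pi> p) s (V, \<psi>) =
      frechet_derivative (\<psi> \<circ> \<pi> \<circ> inv_into U \<phi>) (at (\<phi> p)) (v (U, \<phi>))"
    unfolding v p[symmetric]
    by (rule C1_map_velocity[OF E proj c]) (use sub U V p in \<open>auto simp: fibre_def\<close>)
  moreover have "vector_derivative (\<psi> \<circ> (\<lambda>_. \<pi> p)) (at s within J) = 0"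
    using c nondegenerate_interval_at_neq_bot
    by (intro vector_derivative_within) (auto simp: C1_path_def comp_def)
  ultimately show ?thesis
    using V by (simp add: velocity_def)
qed

text \<open>
  The projection's derivative maps \<open>\<Delta> p\<close> onto the tangent space of \<open>M\<close>, because it is onto and
  kills the vertical space; equality of dimensions then makes it injective on \<open>\<Delta> p\<close>. So the
  vertical space need not be identified with the kernel, which would take the implicit function
  theorem.
\<close>

lemma horizontal_eqI:
  assumes p: "p \<in> points E" and U: "(U, \<phi>) \<in> charts_at E p" and V: "(V, \<psi>) \<in> charts_at M (\<pi> p)"
    and v: "v \<in> \<Delta> p" and w: "w \<in> \<Delta> p"
    and eq: "frechet_derivative (\<psi> \<circ> \<pi> \<circ> inv_into U \<phi>) (at (\<phi> p)) (v (U, \<phi>)) =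
      frechet_derivative (\<psi> \<circ> \<pi> \<circ> inv_into U \<phi>) (at (\<phi> p)) (w (U, \<phi>))"
  shows "v = w"
proof -
  define L where "L = frechet_derivative (\<psi> \<circ> \<pi> \<circ> inv_into U \<phi>) (at (\<phi> p))"
  interpret L: Vector_Spaces.linear "(*s)" "(*s)" L
    unfolding L_def by (rule linear_proj_derivative[OF U V])
  define G where "G = (\<lambda>v :: ('e, 'k, 'n + 'r) tvec. L (v (U, \<phi>)))"
  have "Vector_Spaces.linear tscale (*s) G"
    by unfold_locales (simp_all add: G_def tscale_def L.add L.scale)
  moreover have "G ` \<Delta> p = UNIV"
  proof (intro equalityI subset_UNIV subsetI)
    fix y :: "'k ^ 'n"
    have "surj L"
      using submersion_proj p U V unfolding submersion_def L_def by blast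
    then obtain x where x: "L x = y"
      by (metis surjD)
    \<comment> \<open>Realising \<open>x\<close> as a velocity turns this coordinate vector into an
      element of the tangent space, which can then be split into a vertical and a horizontal
      summand.\<close>
    obtain J c s where c: "C1_path E J c" "nondegenerate J" "s \<in> J" "c s = p"
      "velocity E J c s (U, \<phi>) = x"
      using injective_C1_path_with_velocity[OF E U] by metis
    have "velocity E J c s \<in> tangent_space E p"
      using velocity_in_tangent_space[OF E c(1-3)] c(4) by simp
    then obtain a b where ab: "velocity E J c s = a + b" "a \<in> vertical_space E \<pi> p" "b \<in> \<Delta> p"
      using vertical_plus_horizontal[OF p] by blast
    have "L (a (U, \<phi>)) = 0"
      unfolding L_def by (rule vertical_proj_derivative[OF U V ab(2)])
    moreover have "y = L (a (U, \<phi>) + b (U, \<phi>))"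
      using x c(5) ab(1) by simp
    ultimately have "y = G b"
      by (simp add: G_def L.add)
    then show "y \<in> G ` \<Delta> p"
      using ab(3) by blast
  qed
  ultimately have "inj_on G (\<Delta> p)"
    using linear_dim_eq_surj_imp_inj_on horizontal_subspace horizontal_dim p by blast
  then show ?thesis
    using v w eq unfolding inj_on_def G_def L_def by blast
qed

section \<open>Horizontal lifts as transported curves, and their velocities\<close>

text \<open>By uniqueness the description picks the lift \<open>c\<close>, and restricting it to
  \<open>J\<close> changes nothing because lifts are extensional.\<close>

lemma horizontal_lift_transport_along:
  assumes \<gamma>: "C1_path M J \<gamma>" "s \<in> J" "p \<in> fibre E \<pi> (\<gamma> s)"
  shows "horizontal_lift E \<pi> \<Delta> J \<gamma> (lift_by (transport_along E M \<pi> \<Delta>) J \<gamma> s p)"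
    and "lift_by (transport_along E M \<pi> \<Delta>) J \<gamma> s p s = p"
proof -
  obtain c where c: "horizontal_lift E \<pi> \<Delta> J \<gamma> c" "c s = p"
    using ex1_horizontal_lift[OF \<gamma>] by blast
  have "(THE c. horizontal_lift E \<pi> \<Delta> J \<gamma> c \<and> c s = p) = c"
    by (rule the1_equality) (use ex1_horizontal_lift[OF \<gamma>] c in blast)+
  then have "lift_by (transport_along E M \<pi> \<Delta>) J \<gamma> s p = restrict c J"
    using \<gamma> by (auto simp: lift_by_def transport_along_def restrict_def)
  also have "\<dots> = c"
    using c(1) by (simp add: horizontal_lift_def C1_path_def extensional_restrict)
  finally show "horizontal_lift E \<pi> \<Delta> J \<gamma> (lift_by (transport_along E M \<pi> \<Delta>) J \<gamma> s p)"
    "lift_by (transport_along E M \<pi> \<Delta>) J \<gamma> s p s = p"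
    using c by simp_all
qed

text \<open>A lift is determined by its value at any parameter, so \<open>c\<close> is also the lift
  through \<open>c s\<close>. Choosing \<open>s\<close> freely along one lift gives the composition
  law of the transport.\<close>

lemma transport_along_unique:
  assumes c: "horizontal_lift E \<pi> \<Delta> J \<gamma> c" and \<gamma>: "C1_path M J \<gamma>" "s \<in> J" "t \<in> J"
  shows "transport_along E M \<pi> \<Delta> J \<gamma> s t (c s) = c t"
proof -
  have "c s \<in> fibre E \<pi> (\<gamma> s)"
    using c \<gamma> C1_path_in_points[of E J c s] by (simp add: horizontal_lift_def fibre_def)
  then have "lift_by (transport_along E M \<pi> \<Delta>) J \<gamma> s (c s) = c"
    using ex1_horizontal_lift horizontal_lift_transport_along c \<gamma> by blast
  then show ?thesis
    using \<gamma>(3) by (metis lift_by_def restrict_apply')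
qed

lemma transport_along_paths_transport_along:
  "transport_along_paths E M \<pi> (transport_along E M \<pi> \<Delta>)" (is "transport_along_paths E M \<pi> ?T")
proof -
  have fib: "?T J \<gamma> s t p \<in> fibre E \<pi> (\<gamma> t)"
    and comp: "?T J \<gamma> t u (?T J \<gamma> s t p) = ?T J \<gamma> s u p"
    and id: "?T J \<gamma> s s p = p"
    if \<gamma>: "C1_path M J \<gamma>" "s \<in> J" "p \<in> fibre E \<pi> (\<gamma> s)" and t: "t \<in> J" "u \<in> J" for J \<gamma> s t u p
  proof -
    define c where "c = lift_by ?T J \<gamma> s p"
    have c: "horizontal_lift E \<pi> \<Delta> J \<gamma> c" "c s = p" "\<And>t. t \<in> J \<Longrightarrow> c t = ?T J \<gamma> s t p"
      using horizontal_lift_transport_along[OF \<gamma>] by (auto simp: c_def lift_by_def)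
    show "?T J \<gamma> s t p \<in> fibre E \<pi> (\<gamma> t)"
      using c(1) C1_path_in_points[of E J c t] t(1)
      unfolding c(3)[OF t(1), symmetric] by (simp add: horizontal_lift_def fibre_def)
    show "?T J \<gamma> t u (?T J \<gamma> s t p) = ?T J \<gamma> s u p"
      using transport_along_unique[OF c(1) \<gamma>(1) t] c(3) t by metis
    show "?T J \<gamma> s s p = p"
      using c(2,3) \<gamma>(2) by metis
  qed
  have "if C1_path M J \<gamma> \<and> s \<in> J \<and> t \<in> J
      then ?T J \<gamma> s t \<in> fibre E \<pi> (\<gamma> s) \<rightarrow>\<^sub>E fibre E \<pi> (\<gamma> t) else ?T J \<gamma> s t = undefined" for J \<gamma> s t
  proof (cases "C1_path M J \<gamma> \<and> s \<in> J \<and> t \<in> J")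
    case True
    then have "?T J \<gamma> s t \<in> extensional (fibre E \<pi> (\<gamma> s))"
      by (simp add: transport_along_def)
    then show ?thesis
      using True fib by (auto simp: PiE_def)
  qed (auto simp: transport_along_def)
  then show ?thesis
    unfolding transport_along_paths_def using comp id by blast
qed

text \<open>The two properties that, by \<open>horizontal_eqI\<close>, pin down the velocity of a
  lift: it is horizontal, and it projects to the velocity of \<open>\<gamma>\<close>.\<close>

lemma velocity_transport_along:
  assumes \<gamma>: "C1_path M J \<gamma>" "nondegenerate J" "s \<in> J" and p: "p \<in> fibre E \<pi> (\<gamma> s)"
  shows "velocity E J (lift_by (transport_along E M \<pi> \<Delta>) J \<gamma> s p) s \<in> \<Delta> p"
    and "\<lbrakk>(U, \<phi>) \<in> charts_at E p; (V, \<psi>) \<in> charts_at M (\<pi> p)\<rbrakk> \<Longrightarrow>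
      frechet_derivative (\<psi> \<circ> \<pi> \<circ> inv_into U \<phi>) (at (\<phi> p))
        (velocity E J (lift_by (transport_along E M \<pi> \<Delta>) J \<gamma> s p) s (U, \<phi>)) =
      velocity M J \<gamma> s (V, \<psi>)"
proof -
  define c where "c = lift_by (transport_along E M \<pi> \<Delta>) J \<gamma> s p"
  have c: "C1_path E J c" "\<And>t. t \<in> J \<Longrightarrow> \<pi> (c t) = \<gamma> t" "velocity E J c s \<in> \<Delta> (c s)" "c s = p"
    using horizontal_lift_transport_along[OF \<gamma>(1,3) p] \<gamma>(2,3)
    by (auto simp: c_def horizontal_lift_def)
  show "velocity E J c s \<in> \<Delta> p"
    using c by simp
  assume U: "(U, \<phi>) \<in> charts_at E p" and V: "(V, \<psi>) \<in> charts_at M (\<pi> p)"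
  have "\<pi> p = \<gamma> s"
    using p by (simp add: fibre_def)
  then show "frechet_derivative (\<psi> \<circ> \<pi> \<circ> inv_into U \<phi>) (at (\<phi> p)) (velocity E J c s (U, \<phi>)) =
      velocity M J \<gamma> s (V, \<psi>)"
    using C1_map_velocity[OF E proj c(1) \<gamma>(2,3) c(2), of U \<phi> V \<psi>] U V c(4) by simp
qed

section \<open>The axioms of parallel transport and the generated connection\<close>

text \<open>The axioms on equal velocities and on linear combinations both compare horizontal
  vectors at \<open>p\<close> with the same projection, which \<open>horizontal_eqI\<close>
  identifies.\<close>

lemma parallel_transport_transport_along:
  "parallel_transport E M \<pi> (transport_along E M \<pi> \<Delta>)" (is "parallel_transport E M \<pi> ?T")
  unfolding parallel_transport_def
proof (intro conjI allI impI ballI transport_along_paths_transport_along; (elim conjE)?)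
  show "C1_path E J (lift_by ?T J \<gamma> s p)"
    if "C1_path M J \<gamma>" "s \<in> J" "p \<in> fibre E \<pi> (\<gamma> s)" for J \<gamma> s p
    using horizontal_lift_transport_along[OF that] by (simp add: horizontal_lift_def)
next
  fix J\<^sub>1 \<gamma>\<^sub>1 J\<^sub>2 \<gamma>\<^sub>2 s\<^sub>1 s\<^sub>2 p
  assume \<gamma>\<^sub>1: "C1_path M J\<^sub>1 \<gamma>\<^sub>1" "nondegenerate J\<^sub>1" "s\<^sub>1 \<in> J\<^sub>1" and p: "p \<in> fibre E \<pi> (\<gamma>\<^sub>1 s\<^sub>1)"
    and \<gamma>\<^sub>2: "C1_path M J\<^sub>2 \<gamma>\<^sub>2" "nondegenerate J\<^sub>2" "s\<^sub>2 \<in> J\<^sub>2"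
    and eq: "\<gamma>\<^sub>1 s\<^sub>1 = \<gamma>\<^sub>2 s\<^sub>2" "velocity M J\<^sub>1 \<gamma>\<^sub>1 s\<^sub>1 = velocity M J\<^sub>2 \<gamma>\<^sub>2 s\<^sub>2"
  have pE: "p \<in> points E" and p2: "p \<in> fibre E \<pi> (\<gamma>\<^sub>2 s\<^sub>2)"
    using p eq by (auto simp: fibre_def)
  obtain U \<phi> V \<psi> where U: "(U, \<phi>) \<in> charts_at E p" and V: "(V, \<psi>) \<in> charts_at M (\<pi> p)"
    using ex_chart_at[OF E pE] ex_chart_at[OF M] pE proj_image by (metis imageI)
  show "velocity E J\<^sub>1 (lift_by ?T J\<^sub>1 \<gamma>\<^sub>1 s\<^sub>1 p) s\<^sub>1 = velocity E J\<^sub>2 (lift_by ?T J\<^sub>2 \<gamma>\<^sub>2 s\<^sub>2 p) s\<^sub>2"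
    by (rule horizontal_eqI[OF pE U V])
      (simp_all add: velocity_transport_along \<gamma>\<^sub>1 \<gamma>\<^sub>2 p p2 velocity_transport_along(2)[OF _ _ _ _ U V] eq)
next
  fix J\<^sub>1 \<gamma>\<^sub>1 J\<^sub>2 \<gamma>\<^sub>2 s\<^sub>1 s\<^sub>2 and a\<^sub>1 a\<^sub>2 :: 'k
  assume \<gamma>\<^sub>1: "C1_path M J\<^sub>1 \<gamma>\<^sub>1" "nondegenerate J\<^sub>1" "s\<^sub>1 \<in> J\<^sub>1"
    and \<gamma>\<^sub>2: "C1_path M J\<^sub>2 \<gamma>\<^sub>2" "nondegenerate J\<^sub>2" "s\<^sub>2 \<in> J\<^sub>2" and eq: "\<gamma>\<^sub>1 s\<^sub>1 = \<gamma>\<^sub>2 s\<^sub>2"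
  obtain V \<psi> where V: "(V, \<psi>) \<in> charts_at M (\<gamma>\<^sub>1 s\<^sub>1)"
    using ex_chart_at[OF M C1_path_in_points[OF \<gamma>\<^sub>1(1,3)]] .
  \<comment> \<open>The path is chosen in \<open>M\<close> before \<open>p\<close>, with the
    required combination as its velocity, since one path has to serve every point of the
    fibre.\<close>
  obtain J\<^sub>3 \<gamma>\<^sub>3 s\<^sub>3 where \<gamma>\<^sub>3: "C1_path M J\<^sub>3 \<gamma>\<^sub>3" "nondegenerate J\<^sub>3" "s\<^sub>3 \<in> J\<^sub>3" "\<gamma>\<^sub>3 s\<^sub>3 = \<gamma>\<^sub>1 s\<^sub>1"
    and vel: "velocity M J\<^sub>3 \<gamma>\<^sub>3 s\<^sub>3 (V, \<psi>) =
      a\<^sub>1 *s velocity M J\<^sub>1 \<gamma>\<^sub>1 s\<^sub>1 (V, \<psi>) + a\<^sub>2 *s velocity M J\<^sub>2 \<gamma>\<^sub>2 s\<^sub>2 (V, \<psi>)"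
    using injective_C1_path_with_velocity[OF M V] by metis
  have "velocity E J\<^sub>3 (lift_by ?T J\<^sub>3 \<gamma>\<^sub>3 s\<^sub>3 p) s\<^sub>3 =
      tscale a\<^sub>1 (velocity E J\<^sub>1 (lift_by ?T J\<^sub>1 \<gamma>\<^sub>1 s\<^sub>1 p) s\<^sub>1) +
      tscale a\<^sub>2 (velocity E J\<^sub>2 (lift_by ?T J\<^sub>2 \<gamma>\<^sub>2 s\<^sub>2 p) s\<^sub>2)" (is "?v3 = tscale a\<^sub>1 ?v1 + tscale a\<^sub>2 ?v2")
    if p: "p \<in> fibre E \<pi> (\<gamma>\<^sub>3 s\<^sub>3)" for p
  proof -
    have pE: "p \<in> points E" and p1: "p \<in> fibre E \<pi> (\<gamma>\<^sub>1 s\<^sub>1)" and p2: "p \<in> fibre E \<pi> (\<gamma>\<^sub>2 s\<^sub>2)"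
      and V: "(V, \<psi>) \<in> charts_at M (\<pi> p)"
      using p eq \<gamma>\<^sub>3(4) V by (auto simp: fibre_def)
    obtain U \<phi> where U: "(U, \<phi>) \<in> charts_at E p"
      using ex_chart_at[OF E pE] .
    interpret L: Vector_Spaces.linear "(*s)" "(*s)"
      "frechet_derivative (\<psi> \<circ> \<pi> \<circ> inv_into U \<phi>) (at (\<phi> p))"
      by (rule linear_proj_derivative[OF U V])
    note in\<Delta> = velocity_transport_along(1) and d\<pi> = velocity_transport_along(2)[OF _ _ _ _ U V]
    show ?thesis
    proof (rule horizontal_eqI[OF pE U V])
      show "?v3 \<in> \<Delta> p"
        by (rule in\<Delta>[OF \<gamma>\<^sub>3(1-3) p])
      show "tscale a\<^sub>1 ?v1 + tscale a\<^sub>2 ?v2 \<in> \<Delta> p"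
        using in\<Delta>[OF \<gamma>\<^sub>1 p1] in\<Delta>[OF \<gamma>\<^sub>2 p2] horizontal_subspace[OF pE]
        by (simp add: tvec.subspace_add tvec.subspace_scale)
    qed (simp add: tscale_def L.add L.scale d\<pi>[OF \<gamma>\<^sub>3(1-3) p] d\<pi>[OF \<gamma>\<^sub>1 p1] d\<pi>[OF \<gamma>\<^sub>2 p2] vel)
  qed
  with \<gamma>\<^sub>3 show "\<exists>J\<^sub>3 \<gamma>\<^sub>3. C1_path M J\<^sub>3 \<gamma>\<^sub>3 \<and> nondegenerate J\<^sub>3 \<and>
      (\<exists>s\<^sub>3\<in>J\<^sub>3. \<gamma>\<^sub>3 s\<^sub>3 = \<gamma>\<^sub>1 s\<^sub>1 \<and>
         (\<forall>p\<in>fibre E \<pi> (\<gamma>\<^sub>3 s\<^sub>3).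
            velocity E J\<^sub>3 (lift_by ?T J\<^sub>3 \<gamma>\<^sub>3 s\<^sub>3 p) s\<^sub>3 =
            tscale a\<^sub>1 (velocity E J\<^sub>1 (lift_by ?T J\<^sub>1 \<gamma>\<^sub>1 s\<^sub>1 p) s\<^sub>1) +
            tscale a\<^sub>2 (velocity E J\<^sub>2 (lift_by ?T J\<^sub>2 \<gamma>\<^sub>2 s\<^sub>2 p) s\<^sub>2)))"
    by blast
qed

text \<open>Lifts have horizontal velocities. Conversely, for \<open>w\<close> in
  \<open>\<Delta> p\<close>, an injective path in \<open>M\<close> is taken whose velocity is the
  projection of \<open>w\<close>; the velocity of its lift is horizontal with that projection, so it
  equals \<open>w\<close>.\<close>

lemma generates_transport_along: "generates E M \<pi> (transport_along E M \<pi> \<Delta>) \<Delta>"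
  unfolding generates_def
proof (intro ballI equalityI subsetI)
  fix p v
  assume p: "p \<in> points E" and "v \<in> connection_of_transport E M \<pi> (transport_along E M \<pi> \<Delta>) p"
  then show "v \<in> \<Delta> p"
    using velocity_transport_along(1) by (auto simp: connection_of_transport_def fibre_def)
next
  fix p w
  assume p: "p \<in> points E" and w: "w \<in> \<Delta> p"
  obtain U \<phi> V \<psi> where U: "(U, \<phi>) \<in> charts_at E p" and V: "(V, \<psi>) \<in> charts_at M (\<pi> p)"
    using ex_chart_at[OF E p] ex_chart_at[OF M] p proj_image by (metis imageI)
  obtain J \<gamma> s where \<gamma>: "C1_path M J \<gamma>" "nondegenerate J" "s \<in> J"
    and inj: "inj_on \<gamma> J" "\<gamma> s = \<pi> p" and vel: "velocity M J \<gamma> s (V, \<psi>) =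
      frechet_derivative (\<psi> \<circ> \<pi> \<circ> inv_into U \<phi>) (at (\<phi> p)) (w (U, \<phi>))"
    using injective_C1_path_with_velocity[OF M V] by metis
  have fib: "p \<in> fibre E \<pi> (\<gamma> s)"
    using p inj(2) by (simp add: fibre_def)
  have "w = velocity E J (lift_by (transport_along E M \<pi> \<Delta>) J \<gamma> s p) s"
    using horizontal_eqI[OF p U V w velocity_transport_along(1)[OF \<gamma> fib]]
      velocity_transport_along(2)[OF \<gamma> fib U V] vel by simp
  then show "w \<in> connection_of_transport E M \<pi> (transport_along E M \<pi> \<Delta>) p"
    unfolding connection_of_transport_def using \<gamma> inj by blast
qed

section \<open>Uniqueness of the generating transport\<close>

text \<open>The path \<open>\<gamma>\<close> may fail to be injective, while
  \<open>connection_of_transport\<close> collects velocities along injective paths only. The axiom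
  on equal velocities passes from \<open>\<gamma>\<close> to an injective path.\<close>

lemma horizontal_lift_lift_by:
  assumes par: "parallel_transport E M \<pi> I" and gen: "generates E M \<pi> I \<Delta>"
    and \<gamma>: "C1_path M J \<gamma>" "s \<in> J" and p: "p \<in> fibre E \<pi> (\<gamma> s)"
  shows "horizontal_lift E \<pi> \<Delta> J \<gamma> (lift_by I J \<gamma> s p)"
proof -
  define c where "c = lift_by I J \<gamma> s p"
  have c: "c t = I J \<gamma> s t p" if "t \<in> J" for t
    using that by (simp add: c_def lift_by_def)
  have path: "C1_path E J c"
    using conjunct1[OF conjunct2[OF par[unfolded parallel_transport_def]]] \<gamma> p
    unfolding c_def by blast
  have trans: "transport_along_paths E M \<pi> I"
    by (rule conjunct1[OF par[unfolded parallel_transport_def]])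
  have fib: "c t \<in> fibre E \<pi> (\<gamma> t)" if "t \<in> J" for t
  proof -
    have "I J \<gamma> s t \<in> fibre E \<pi> (\<gamma> s) \<rightarrow>\<^sub>E fibre E \<pi> (\<gamma> t)"
      using trans \<gamma> that unfolding transport_along_paths_def by meson
    then show ?thesis
      using c[OF that] p by auto
  qed
  have "velocity E J c t \<in> \<Delta> (c t)" if J: "nondegenerate J" and t: "t \<in> J" for t
  proof -
    \<comment> \<open>The composition law lets the same curve start from \<open>t\<close> instead of
      \<open>s\<close>, so that the axioms, which speak of the base parameter, apply at every
      \<open>t\<close>.\<close>
    have "I J \<gamma> t u (c t) = c u" if "u \<in> J" for u
      using trans \<gamma> p t that c unfolding transport_along_paths_def by metis
    then have ct: "lift_by I J \<gamma> t (c t) = c"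
      by (auto simp: lift_by_def c_def)
    obtain V \<psi> where V: "(V, \<psi>) \<in> charts_at M (\<gamma> t)"
      using ex_chart_at[OF M C1_path_in_points[OF \<gamma>(1) t]] .
    obtain J' \<gamma>' t' where \<gamma>': "C1_path M J' \<gamma>'" "nondegenerate J'" "t' \<in> J'"
      and inj: "inj_on \<gamma>' J'" "\<gamma>' t' = \<gamma> t"
      and vel: "velocity M J' \<gamma>' t' (V, \<psi>) = velocity M J \<gamma> t (V, \<psi>)"
      using injective_C1_path_with_velocity[OF M V] by metis
    have "velocity M J \<gamma> t = velocity M J' \<gamma>' t'"
      using tangent_space_eqI[OF _ _ V] velocity_in_tangent_space[OF M \<gamma>']
        velocity_in_tangent_space[OF M \<gamma>(1) J t] inj(2) vel by simp
    \<comment> \<open>The third conjunct of \<open>parallel_transport\<close> is the axiom on equal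
      velocities.\<close>
    then have "velocity E J (lift_by I J \<gamma> t (c t)) t = velocity E J' (lift_by I J' \<gamma>' t' (c t)) t'"
      using conjunct1[OF conjunct2[OF conjunct2[OF par[unfolded parallel_transport_def]]]]
        \<gamma>(1) J t \<gamma>' inj(2)[symmetric] fib[OF t] by blast
    then have "velocity E J c t = velocity E J' (lift_by I J' \<gamma>' t' (c t)) t'"
      by (simp only: ct)
    moreover have "\<gamma>' t' = \<pi> (c t)" "c t \<in> points E"
      using inj(2) fib[OF t] by (simp_all add: fibre_def)
    ultimately have "velocity E J c t \<in> connection_of_transport E M \<pi> I (c t)"
      unfolding connection_of_transport_def using \<gamma>' inj(1) by blast
    then show ?thesis
      using gen \<open>c t \<in> points E\<close> unfolding generates_def by simp
  qed
  then show ?thesis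
    using path fib unfolding c_def[symmetric] horizontal_lift_def by (simp add: fibre_def)
qed

text \<open>On the fibre, the curve transported by \<open>I\<close> is the horizontal lift through
  \<open>p\<close>, which fixes its values. Off the fibre and outside the domain both functions take
  the same default value.\<close>

lemma parallel_transport_eq_transport_along:
  assumes par: "parallel_transport E M \<pi> I" and gen: "generates E M \<pi> I \<Delta>"
  shows "I = transport_along E M \<pi> \<Delta>"
proof (intro ext)
  fix J \<gamma> s t p
  have trans: "transport_along_paths E M \<pi> I"
    by (rule conjunct1[OF par[unfolded parallel_transport_def]])
  show "I J \<gamma> s t p = transport_along E M \<pi> \<Delta> J \<gamma> s t p"
  proof (cases "C1_path M J \<gamma> \<and> s \<in> J \<and> t \<in> J")
    case True
    show ?thesis
    proof (cases "p \<in> fibre E \<pi> (\<gamma> s)")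
      case p: True
      have "lift_by I J \<gamma> s p s = p"
        using trans True p unfolding transport_along_paths_def lift_by_def by simp
      then show ?thesis
        using transport_along_unique[OF horizontal_lift_lift_by[OF par gen, of J \<gamma> s p], of s t] True p
        by (simp add: lift_by_def)
    next
      case False
      have "I J \<gamma> s t \<in> fibre E \<pi> (\<gamma> s) \<rightarrow>\<^sub>E fibre E \<pi> (\<gamma> t)"
        using trans True unfolding transport_along_paths_def by meson
      then show ?thesis
        using True False by (auto simp: transport_along_def)
    qed
  next
    case False
    then have "I J \<gamma> s t = undefined"
      using trans unfolding transport_along_paths_def by meson
    then show ?thesis
      using False by (auto simp: transport_along_def)
  qed
qed

end

theorem theorem7p1:
  fixes E :: "('e, 'k::{real_normed_field,euclidean_space}, 'n::finite + 'r::finite) mfd"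
    and M :: "('m, 'k, 'n) mfd"
    and \<pi> :: "'e \<Rightarrow> 'm"
    and \<Delta> :: "'e \<Rightarrow> ('e, 'k, 'n + 'r) tvec set"
  assumes "C1_bundle E M \<pi>"
    and "connection E M \<pi> \<Delta>"
  shows "(\<exists>!I. parallel_transport E M \<pi> I \<and> generates E M \<pi> I \<Delta>) \<and>
    (\<forall>I. parallel_transport E M \<pi> I \<and> generates E M \<pi> I \<Delta> \<longrightarrow>
       (\<forall>\<sigma> \<tau> \<gamma>. \<sigma> \<le> \<tau> \<and> C1_path M {\<sigma>..\<tau>} \<gamma> \<longrightarrow>
          transport_of_connection E \<pi> \<Delta> \<sigma> \<tau> \<gamma> = I {\<sigma>..\<tau>} \<gamma> \<sigma> \<tau>))"
proof -
  \<comment> \<open>One equivalence yields existence, uniqueness and, with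
    \<open>transport_of_connection_eq\<close>, the value on closed intervals.\<close>
  have "parallel_transport E M \<pi> I \<and> generates E M \<pi> I \<Delta> \<longleftrightarrow> I = transport_along E M \<pi> \<Delta>" for I
    using parallel_transport_transport_along[OF assms] generates_transport_along[OF assms]
      parallel_transport_eq_transport_along[OF assms] by blast
  then show ?thesis
    using transport_of_connection_eq by auto
qed

end
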